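(* Let $n\ge 1$ and let $t_1,\dots,t_n$ be sampling times. Let $X = X_T + X_S + X_R$ be a real time series signal sampled at these times, where $X_T, X_S, X_R\in\mathbb{R}^n$ are its trend, seasonal and residual components, with entries $X_T^i, X_S^i, X_R^i$ being the values at time $t_i$. Let $E=\{e_1,\dots,e_n\}$ be an orthogonal basis of $\mathbb{R}^n$, and write $X_S=\sum_{i=1}^n a_i e_i$ and $X_T=\sum_{i=1}^n b_i e_i$ with $a_i,b_i\in\mathbb{R}$. Let $E_S=\{e_i\in E : a_i\neq 0\}$ and $E_T=\{e_i\in E : b_i\neq 0\}$. If $X_S$ and $X_T$ are not orthogonal, i.e. $\sum_{i=1}^n X_T^i X_S^i\neq 0$, then $E_T\cap E_S\neq\emptyset$ (i.e. $E$ cannot disentangle the two signals onto two disjoint sets of basis vectors).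
   Context: Orthogonality is with respect to the standard Euclidean inner product on $\mathbb{R}^n$; an orthogonal basis consists of $n$ nonzero pairwise orthogonal vectors, not necessarily of unit length. The components $X_T$, $X_S$, $X_R$ come from an additive decomposition of the signal $X$ into trend (non-periodic), seasonal (periodic) and residual parts. *)

theory Defs
  imports "HOL-Analysis.Analysis"
begin

definition sample :: "('n::finite \<Rightarrow> real) \<Rightarrow> (real \<Rightarrow> real) \<Rightarrow> real ^ 'n" where
  "sample t x = (\<chi> i. x (t i))"

text \<open>The index type of the family is that of the coordinates, so the family has exactly
  as many members as the dimension of the space. Unit length is not required.\<close>

definition orthogonal_basis :: "('n::finite \<Rightarrow> real ^ 'n) \<Rightarrow> bool" where
  "orthogonal_basis e \<longleftrightarrow>
    (\<forall>i. e i \<noteq> 0) \<and> (\<forall>i j. i \<noteq> j \<longrightarrow> orthogonal (e i) (e j))"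

lemma orthogonal_basis_is_basis:
  fixes e :: "'n::finite \<Rightarrow> real ^ 'n"
  assumes "orthogonal_basis e"
  shows "inj e" and "independent (range e)" and "span (range e) = UNIV"
proof -
  have nz: "e i \<noteq> 0" and orth: "i \<noteq> j \<Longrightarrow> orthogonal (e i) (e j)" for i j
    using assms by (auto simp: orthogonal_basis_def)
  show inj: "inj e"
  proof (rule injI, rule ccontr)
    fix i j assume "e i = e j" and "i \<noteq> j"
    with orth[of i j] have "orthogonal (e j) (e j)" by simp
    with nz[of j] show False by (simp add: orthogonal_self)
  qed
  show ind: "independent (range e)"
  proof (rule pairwise_orthogonal_independent)
    show "pairwise orthogonal (range e)"
    proof (rule pairwiseI)
      fix u v assume uv: "u \<in> range e" "v \<in> range e" "u \<noteq> v"
      then obtain i j where ij: "u = e i" "v = e j" by blast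
      with uv have "i \<noteq> j" by auto
      then show "orthogonal u v" using orth ij by simp
    qed
    show "0 \<notin> range e"
    proof
      assume "0 \<in> range e"
      then obtain i where "0 = e i" by (rule rangeE)
      with nz[of i] show False by simp
    qed
  qed
  have "card (range e) = DIM(real ^ 'n)"
    using inj by (simp add: card_image)
  then have "UNIV \<subseteq> span (range e)"
    by (intro card_ge_dim_independent ind) simp_all
  then show "span (range e) = UNIV"
    by (rule top.extremum_uniqueI)
qed

lemma orthogonal_vec_iff_sum:
  fixes u v :: "real ^ 'n"
  shows "orthogonal u v \<longleftrightarrow> (\<Sum>i\<in>UNIV. u $ i * v $ i) = 0"
  by (simp add: orthogonal_def inner_vec_def)

end

theory Submission
  imports Defs
begin

text \<open>Expand \<open>X_T \<bullet> X_S\<close> bilinearly in the basis. Orthogonality kills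
  every cross term, so only the diagonal terms \<open>b i * a i * (e i \<bullet> e i)\<close> can
  contribute. A nonzero inner product therefore forces some index with both coefficients nonzero,
  and that basis vector is shared.\<close>

theorem theorem3p1:
  fixes t :: "'n::finite \<Rightarrow> real"
    and x x_T x_S x_R :: "real \<Rightarrow> real"
    and X X_T X_S X_R :: "real ^ 'n"
    and e :: "'n \<Rightarrow> real ^ 'n"
    and a b :: "'n \<Rightarrow> real"
    and E E_S E_T :: "(real ^ 'n) set"
  assumes "X = sample t x" and "X_T = sample t x_T" and "X_S = sample t x_S"
    and "X_R = sample t x_R"
    and "X = X_T + X_S + X_R"
    and "orthogonal_basis e" and "E = range e"
    and "X_S = (\<Sum>i\<in>UNIV. a i *\<^sub>R e i)"
    and "X_T = (\<Sum>i\<in>UNIV. b i *\<^sub>R e i)"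
    and "E_S = {v \<in> E. \<exists>i. v = e i \<and> a i \<noteq> 0}"
    and "E_T = {v \<in> E. \<exists>i. v = e i \<and> b i \<noteq> 0}"
    and "\<not> orthogonal X_T X_S"
  shows "E_T \<inter> E_S \<noteq> {}"
proof -
  have "X_T \<bullet> X_S = (\<Sum>j\<in>UNIV. \<Sum>i\<in>UNIV. b i * a j * (e i \<bullet> e j))"
    unfolding assms(8,9)
    by (simp add: inner_sum_left inner_sum_right sum_distrib_left mult_ac)
  with \<open>\<not> orthogonal X_T X_S\<close>
  \<comment> \<open>The elimination rule acts twice, on the outer and then the inner sum, to extract
    one nonzero term.\<close>
  obtain i j where "b i * a j * (e i \<bullet> e j) \<noteq> 0"
    by (auto simp: orthogonal_def elim!: sum.not_neutral_contains_not_neutral)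
  moreover from this have "i = j"
    using \<open>orthogonal_basis e\<close> by (auto simp: orthogonal_basis_def orthogonal_def)
  \<comment> \<open>With \<open>i = j\<close>, the nonzero product yields both
    \<open>b i \<noteq> 0\<close> and \<open>a i \<noteq> 0\<close>.\<close>
  ultimately have "e i \<in> E_T \<inter> E_S"
    using assms(7,10,11) by auto
  then show ?thesis by blast
qed

end
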